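(* For every integer $k\ge 4$, $Z_1\le C_k$.
   Context: All graphs are finite and simple, considered up to isomorphism. An edge-colored graph is a pair $(G,c)$ with $c\colon E(G)\to\mathbb{N}$ an arbitrary map (not necessarily proper); it is colored in $t$ or more colors if $|c(E(G))|\ge t$. A subgraph (not necessarily induced) is rainbow if its edges receive pairwise distinct colors. $(G,c)$ is rainbow $H$-free if $G$ contains no rainbow subgraph isomorphic to $H$. For graphs $H_1,H_2$, write $H_1\le H_2$ if there is a positive integer $t$ such that every rainbow $H_1$-free edge-colored complete graph colored in $t$ or more colors is rainbow $H_2$-free. $C_k$ is the cycle on $k$ vertices. $Z_1$ is the graph obtained from the triangle $C_3$ by attaching one pendant edge (i.e., a triangle plus a new vertex adjacent to exactly one triangle vertex). *)

theory Defs
  imports Main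
begin

type_synonym 'a graph = "'a set \<times> 'a set set"

abbreviation verts :: "'a graph \<Rightarrow> 'a set" where
  "verts G \<equiv> fst G"

abbreviation edges :: "'a graph \<Rightarrow> 'a set set" where
  "edges G \<equiv> snd G"

definition simple_graph :: "'a graph \<Rightarrow> bool" where
  "simple_graph G \<longleftrightarrow> finite (verts G) \<and> (\<forall>e\<in>edges G. e \<subseteq> verts G \<and> card e = 2)"

definition complete_graph :: "'a graph \<Rightarrow> bool" where
  "complete_graph G \<longleftrightarrow>
     simple_graph G \<and> (\<forall>u\<in>verts G. \<forall>v\<in>verts G. u \<noteq> v \<longrightarrow> {u, v} \<in> edges G)"

text \<open>Not necessarily induced.\<close>
definition subgraph :: "'a graph \<Rightarrow> 'a graph \<Rightarrow> bool" where
  "subgraph S G \<longleftrightarrow> simple_graph S \<and> verts S \<subseteq> verts G \<and> edges S \<subseteq> edges G"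

definition isomorphic :: "'a graph \<Rightarrow> 'b graph \<Rightarrow> bool" where
  "isomorphic G H \<longleftrightarrow>
     (\<exists>f. bij_betw f (verts G) (verts H) \<and>
          (\<forall>u\<in>verts G. \<forall>v\<in>verts G. {u, v} \<in> edges G \<longleftrightarrow> {f u, f v} \<in> edges H))"

text \<open>An edge coloring of \<open>G\<close> is a map on all sets of vertices, of which only the values on
  \<open>edges G\<close> are ever used; it need not be proper.\<close>

definition rainbow :: "('a set \<Rightarrow> nat) \<Rightarrow> 'a graph \<Rightarrow> bool" where
  "rainbow c S \<longleftrightarrow> inj_on c (edges S)"

definition colored_in_at_least :: "nat \<Rightarrow> 'a graph \<Rightarrow> ('a set \<Rightarrow> nat) \<Rightarrow> bool" where
  "colored_in_at_least t G c \<longleftrightarrow> t \<le> card (c ` edges G)"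

definition rainbow_free :: "'h graph \<Rightarrow> 'a graph \<Rightarrow> ('a set \<Rightarrow> nat) \<Rightarrow> bool" where
  "rainbow_free H G c \<longleftrightarrow> \<not> (\<exists>S. subgraph S G \<and> rainbow c S \<and> isomorphic S H)"

text \<open>The host graphs have natural numbers as vertices. Since every finite graph is isomorphic to
  such a graph, this covers all edge-colored complete graphs with one and the same \<open>t\<close>.\<close>

definition rainbow_le :: "'h graph \<Rightarrow> 'k graph \<Rightarrow> bool" where
  "rainbow_le H\<^sub>1 H\<^sub>2 \<longleftrightarrow>
     (\<exists>t>0. \<forall>(G :: nat graph) c.
        complete_graph G \<and> colored_in_at_least t G c \<and> rainbow_free H\<^sub>1 G c
        \<longrightarrow> rainbow_free H\<^sub>2 G c)"

text \<open>Meaningful for \<open>k \<ge> 3\<close> only.\<close>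
definition cycle_graph :: "nat \<Rightarrow> nat graph" where
  "cycle_graph k = ({..<k}, {{i, (i + 1) mod k} | i. i < k})"

definition Z1 :: "nat graph" where
  "Z1 = (insert 3 (verts (cycle_graph 3)), insert {0, 3} (edges (cycle_graph 3)))"

end

theory Submission
  imports Defs
begin

text \<open>In a rainbow \<open>Z\<^sub>1\<close>-free coloring there is no rainbow \<open>C\<^sub>k\<close> with \<open>k \<ge> 4\<close> at all, so \<open>t = 1\<close> works.
  Let \<open>v\<^sub>1 \<dots> v\<^sub>k\<close> be a rainbow cycle and consider the chord \<open>v\<^sub>1v\<^sub>3\<close>. If the triangle \<open>v\<^sub>1v\<^sub>2v\<^sub>3\<close>
  were rainbow, then the pendant edges \<open>v\<^sub>3v\<^sub>4\<close> and \<open>v\<^sub>1v\<^sub>k\<close>, whose colors differ, would both have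
  the color of the chord. So the chord has the color of \<open>v\<^sub>1v\<^sub>2\<close> or of \<open>v\<^sub>2v\<^sub>3\<close>, and skipping \<open>v\<^sub>2\<close>
  gives a rainbow \<open>C\<^bsub>k-1\<^esub>\<close>. Descend to a rainbow triangle; the vertex skipped last provides
  a pendant edge that completes it to a rainbow \<open>Z\<^sub>1\<close>.\<close>

definition walk_edges :: "'a list \<Rightarrow> 'a set list" where
  "walk_edges xs = map2 (\<lambda>x y. {x, y}) xs (tl xs)"

lemma walk_edges_Cons_Cons [simp]: "walk_edges (x # y # ys) = {x, y} # walk_edges (y # ys)"
  by (simp add: walk_edges_def)

lemma walk_edges_singleton [simp]: "walk_edges [x] = []"
  by (simp add: walk_edges_def)

lemma nth_walk_edges:
  "Suc i < length xs \<Longrightarrow> walk_edges xs ! i = {xs ! i, xs ! Suc i}"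
  by (simp add: walk_edges_def nth_tl)

text \<open>Locates the closing edge of a closed walk whose middle part is an unspecified
  list.\<close>

lemma last_edge_in_walk_edges: "{last (x # xs), y} \<in> set (walk_edges (x # xs @ [y]))"
  by (induction xs arbitrary: x) auto

lemma Z1_eq: "Z1 = ({0, 1, 2, 3}, {{0, 1}, {1, 2}, {2, 0}, {0, 3}})"
proof -
  have verts: "{..<3::nat} = {0, 1, 2}"
    by auto
  have "{{i, (i + 1) mod 3} | i. i < 3} = (\<lambda>i. {i, (i + 1) mod 3}) ` {..<3::nat}"
    by auto
  also have "\<dots> = {{0, 1}, {1, 2}, {2, 0}}"
    unfolding verts by (simp add: numeral_2_eq_2)
  finally have "cycle_graph 3 = ({0, 1, 2}, {{0, 1}, {1, 2}, {2, 0}})"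
    unfolding cycle_graph_def verts by simp
  moreover have "insert 3 {0, 1, 2} = {0, 1, 2, 3 :: nat}"
    by blast
  moreover have "insert {0, 3} {{0, 1}, {1, 2}, {2, 0}} = {{0, 1}, {1, 2}, {2, 0}, {0, 3 :: nat}}"
    by blast
  ultimately show ?thesis
    unfolding Z1_def by simp
qed

lemma rainbow_Z1_free_paw:
  assumes "complete_graph G" "rainbow_free Z1 G c"
    and "{x, y, z, w} \<subseteq> verts G" "distinct [x, y, z, w]"
  shows "\<not> distinct [c {x, y}, c {y, z}, c {z, x}, c {x, w}]"
proof
  assume dist: "distinct [c {x, y}, c {y, z}, c {z, x}, c {x, w}]"
  define S where "S = ({x, y, z, w}, {{x, y}, {y, z}, {z, x}, {x, w}})"
  \<comment> \<open>\<open>x\<close> must go to 0, the vertex of \<open>Z1\<close> that carries the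
    pendant edge; the default value 3 is for \<open>w\<close>.\<close>
  define f :: "_ \<Rightarrow> nat"
    where "f = (\<lambda>v. if v = x then 0 else if v = y then 1 else if v = z then 2 else 3)"
  have "subgraph S G"
    using assms by (auto simp: S_def subgraph_def simple_graph_def complete_graph_def)
  moreover have "rainbow c S"
    using dist by (auto simp: S_def rainbow_def)
  moreover have "bij_betw f (verts S) (verts Z1)"
    using assms(4) by (auto simp: S_def Z1_eq f_def bij_betw_def inj_on_def)
  moreover have "\<forall>u\<in>verts S. \<forall>v\<in>verts S. {u, v} \<in> edges S \<longleftrightarrow> {f u, f v} \<in> edges Z1"
    using assms(4) by (auto simp: S_def Z1_eq f_def doubleton_eq_iff)
  ultimately show False
    using assms(2) unfolding rainbow_free_def isomorphic_def by blast
qed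

lemma rainbow_Z1_free_no_rainbow_closed_walk:
  assumes "complete_graph G" "rainbow_free Z1 G c"
    and "length xs \<ge> 4" "distinct xs" "set xs \<subseteq> verts G"
  shows "\<not> distinct (map c (walk_edges (xs @ [hd xs])))"
  using assms(3-)
proof (induction xs rule: length_induct)
  case (1 xs)
  obtain x y z w ys where xs: "xs = x # y # z # w # ys"
    using 1(2) by (auto simp: numeral_eq_Suc Suc_le_length_iff)
  note paw = rainbow_Z1_free_paw[OF assms(1,2)]
  show ?case
  proof
    assume dist: "distinct (map c (walk_edges (xs @ [hd xs])))"
    \<comment> \<open>The neighbor of \<open>x\<close> on the cycle other than \<open>y\<close>; it
      is \<open>w\<close> itself when the cycle has length 4.\<close>
    define u where "u = last (w # ys)"
    have u: "u \<in> set (w # ys)"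
      by (simp add: u_def)
    have in_walk: "{u, x} \<in> set (walk_edges (w # ys @ [x]))"
      unfolding u_def by (rule last_edge_in_walk_edges)
    have colors: "c {x, y} \<noteq> c {y, z}" "c {x, y} \<noteq> c {z, w}" "c {y, z} \<noteq> c {z, w}"
      "c {u, x} \<noteq> c {x, y}" "c {u, x} \<noteq> c {y, z}" "c {u, x} \<noteq> c {z, w}"
      using dist in_walk by (auto simp: xs rev_image_eqI)
    have "\<not> distinct [c {x, y}, c {y, z}, c {z, x}, c {x, u}]"
      using u 1(3,4) by (intro paw) (auto simp: xs)
    moreover have "\<not> distinct [c {z, x}, c {x, y}, c {y, z}, c {z, w}]"
      using 1(3,4) by (intro paw) (auto simp: xs)
    ultimately have chord: "c {x, z} = c {x, y} \<or> c {x, z} = c {y, z}"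
      using colors by (auto simp: insert_commute)
    show False
    proof (cases ys)
      case Nil
      have comm: "c {w, x} = c {u, x}" "c {z, y} = c {y, z}"
        by (simp_all add: Nil u_def insert_commute)
      \<comment> \<open>Length 4: both paws consist of the triangle \<open>x\<close>,
        \<open>z\<close>, \<open>w\<close> and a pendant edge to \<open>y\<close>. The chord has the
        color of one of the two edges at \<open>y\<close>, so the paw using the other one is
        rainbow.\<close>
      have "\<not> distinct [c {x, z}, c {z, w}, c {w, x}, c {x, y}]"
        using 1(3,4) by (intro paw) (auto simp: xs)
      moreover have "\<not> distinct [c {z, w}, c {w, x}, c {x, z}, c {z, y}]"
        using 1(3,4) by (intro paw) (auto simp: xs)
      ultimately show False
        using chord colors by (simp add: comm) metis
    next
      case (Cons v vs)
      \<comment> \<open>The chord replaces both edges at \<open>y\<close> and repeats the color of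
        one of them, so no new color arises. Since \<open>ys\<close> is nonempty, the shorter cycle
        still has at least 4 vertices.\<close>
      have "distinct (map c (walk_edges ((x # z # w # ys) @ [x])))"
        using chord by (rule disjE) (use dist in \<open>simp_all add: xs\<close>)
      moreover have "\<not> distinct (map c (walk_edges ((x # z # w # ys) @ [x])))"
        using 1(1)[rule_format, of "x # z # w # ys"] 1(3,4) by (simp add: xs Cons)
      ultimately show False
        by blast
    qed
  qed
qed

text \<open>For \<open>k = 2\<close> this fails: both indices give the edge
  \<open>{0, 1}\<close>.\<close>

lemma cycle_graph_edge_inject:
  fixes k :: nat
  assumes "k \<ge> 3" "i < k" "j < k" "{i, (i + 1) mod k} = {j, (j + 1) mod k}"
  shows "i = j"
proof -
  have "(m + 1) mod k = (if m + 1 = k then 0 else m + 1)" if "m < k" for m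
    using that by auto
  with assms show ?thesis
    by (auto simp: doubleton_eq_iff split: if_splits)
qed

text \<open>Listing the vertices through the inverse of an isomorphism turns the cycle into a list,
  where skipping a vertex is deleting an entry.\<close>

lemma rainbow_cycle_closed_walk:
  assumes "k \<ge> 3" "subgraph S G" "rainbow c S" "isomorphic S (cycle_graph k)"
  obtains xs where "length xs = k" "distinct xs" "set xs \<subseteq> verts G"
    "distinct (map c (walk_edges (xs @ [hd xs])))"
proof -
  obtain f where f: "bij_betw f (verts S) {..<k}"
    and edge_iff: "\<And>u v. u \<in> verts S \<Longrightarrow> v \<in> verts S \<Longrightarrow>
      {u, v} \<in> edges S \<longleftrightarrow> {f u, f v} \<in> {{i, (i + 1) mod k} | i. i < k}"
    using assms(4) by (auto simp: isomorphic_def cycle_graph_def)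
  define g where "g = inv_into (verts S) f"
  have g: "bij_betw g {..<k} (verts S)"
    unfolding g_def by (rule bij_betw_inv_into[OF f])
  have fg: "f (g i) = i" if "i < k" for i
    using f that by (simp add: g_def bij_betw_inv_into_right)
  have gS: "g i \<in> verts S" if "i < k" for i
    using g that by (auto simp: bij_betw_def)
  define e where "e = (\<lambda>i. {g i, g ((i + 1) mod k)})"
  define xs where "xs = map g [0..<k]"
  have len: "length xs = k"
    by (simp add: xs_def)
  have walk: "walk_edges (xs @ [hd xs]) = map e [0..<k]"
  proof (rule nth_equalityI)
    fix i assume "i < length (walk_edges (xs @ [hd xs]))"
    then have i: "i < k"
      by (simp add: walk_edges_def xs_def)
    have "(xs @ [hd xs]) ! i = g i"
      using i by (simp add: xs_def nth_append)
    moreover have "(xs @ [hd xs]) ! Suc i = g ((i + 1) mod k)"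
      \<comment> \<open>At the last index the next entry is the appended \<open>hd xs\<close>, that
        is \<open>g 0\<close>, as the \<open>mod\<close> demands.\<close>
      using i by (cases "Suc i = k") (auto simp: xs_def nth_append hd_map)
    ultimately show "walk_edges (xs @ [hd xs]) ! i = map e [0..<k] ! i"
      using i by (simp add: nth_walk_edges len e_def)
  qed (simp add: walk_edges_def xs_def)
  have e: "e i \<in> edges S" if "i < k" for i
    using that gS edge_iff[of "g i" "g ((i + 1) mod k)"] by (auto simp: e_def fg)
  have "inj_on e {..<k}"
  proof (rule inj_onI)
    fix i j assume ij: "i \<in> {..<k}" "j \<in> {..<k}" "e i = e j"
    \<comment> \<open>Applying \<open>f\<close> carries the edges back to
      \<open>cycle_graph k\<close>, where the index is determined.\<close>
    have image_e: "f ` e i = {i, (i + 1) mod k}" if "i < k" for i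
      using that by (simp add: e_def fg)
    have "{i, (i + 1) mod k} = {j, (j + 1) mod k}"
      using ij image_e[of i] image_e[of j] by simp
    with ij show "i = j"
      using cycle_graph_edge_inject[OF assms(1)] by auto
  qed
  then have "inj_on (c \<circ> e) {..<k}"
    using assms(3) e by (intro comp_inj_on) (auto simp: rainbow_def intro: inj_on_subset)
  then have "distinct (map c (walk_edges (xs @ [hd xs])))"
    by (simp add: walk distinct_map atLeast0LessThan comp_def)
  moreover have "distinct xs" "set xs \<subseteq> verts G"
    using g assms(2) by (auto simp: xs_def distinct_map bij_betw_def atLeast0LessThan subgraph_def)
  ultimately show thesis
    by (intro that[of xs]) (auto simp: xs_def)
qed

theorem theorem5:
  fixes k :: nat
  assumes "k \<ge> 4"
  shows "rainbow_le Z1 (cycle_graph k)"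
proof -
  have "rainbow_free (cycle_graph k) G c" if "complete_graph G" "rainbow_free Z1 G c"
    for G :: "nat graph" and c
    unfolding rainbow_free_def
  proof safe
    fix S :: "nat graph"
    assume "subgraph S G" "rainbow c S" "isomorphic S (cycle_graph k)"
    then obtain xs where "length xs = k" "distinct xs" "set xs \<subseteq> verts G"
      "distinct (map c (walk_edges (xs @ [hd xs])))"
      using rainbow_cycle_closed_walk[of k S G c] assms by auto
    then show False
      using rainbow_Z1_free_no_rainbow_closed_walk[OF that] assms by blast
  qed
  then show ?thesis
    unfolding rainbow_le_def by blast
qed

end
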